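(* Let $\mathfrak{X},\mathfrak{Y},\mathfrak{Z}$ be linear spaces over $\mathbb{K}$ and let $A\subseteq\mathfrak{X}\times\mathfrak{Z}$ and $B\subseteq\mathfrak{X}\times\mathfrak{Y}$ be two linear relations. The following statements are equivalent: (i) there exists a linear relation $C\subseteq\mathfrak{Y}\times\mathfrak{Z}$ such that $A\subseteq CB$; (ii) $\mathrm{dom}\,A\subseteq\mathrm{dom}\,B$; (iii) $A\subseteq AB^{-1}B$.
   Context: $\mathbb{K}$ is $\mathbb{R}$ or $\mathbb{C}$. A linear relation between linear spaces $\mathfrak{X}$ and $\mathfrak{Y}$ is a linear subspace $R$ of $\mathfrak{X}\times\mathfrak{Y}$. Its inverse is $R^{-1}=\{(y,x):(x,y)\in R\}\subseteq\mathfrak{Y}\times\mathfrak{X}$. The domain is $\mathrm{dom}\,R=\{x:(x,y)\in R\text{ for some }y\in\mathfrak{Y}\}$. For linear relations $R\subseteq\mathfrak{X}\times\mathfrak{Y}$ and $S\subseteq\mathfrak{Y}\times\mathfrak{Z}$ the product is $SR=\{(x,z):(x,y)\in R\text{ and }(y,z)\in S\text{ for some }y\in\mathfrak{Y}\}\subseteq\mathfrak{X}\times\mathfrak{Z}$. *)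

theory Defs
  imports "HOL-Analysis.Product_Vector"
begin

text \<open>The scalar fields that are the real or the complex numbers, up to an isomorphism of fields.
  A bijection that respects addition and multiplication also respects 0 and 1.\<close>

class real_or_complex = field +
  assumes real_or_complex:
    "(\<exists>f :: 'a \<Rightarrow> real. bij f \<and> (\<forall>a b. f (a + b) = f a + f b) \<and> (\<forall>a b. f (a * b) = f a * f b)) \<or>
     (\<exists>f :: 'a \<Rightarrow> complex. bij f \<and> (\<forall>a b. f (a + b) = f a + f b) \<and> (\<forall>a b. f (a * b) = f a * f b))"

instance real :: real_or_complex
  by standard (intro disjI1 exI[of _ id], simp)

instance complex :: real_or_complex
  by standard (intro disjI2 exI[of _ id], simp)

text \<open>\<open>module_prod.scale sX sY\<close> is the componentwise scalar multiplication on pairs. Since a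
  linear relation is a set of pairs, its domain is \<^const>\<open>Domain\<close> and its inverse is
  \<^const>\<open>converse\<close>. The library composes relations in diagrammatic order: the product written
  \<open>S R\<close> (first \<open>R\<close>, then \<open>S\<close>) is \<open>R O S\<close>.\<close>

definition linear_relation ::
  "('k::field \<Rightarrow> 'x::ab_group_add \<Rightarrow> 'x) \<Rightarrow> ('k \<Rightarrow> 'y::ab_group_add \<Rightarrow> 'y) \<Rightarrow> ('x \<times> 'y) set \<Rightarrow> bool"
  where "linear_relation sX sY R \<longleftrightarrow> module.subspace (module_prod.scale sX sY) R"

end

theory Submission
  imports Defs
begin

text \<open>The canonical candidate for C is A B^{-1}, written \<open>B\<inverse> O A\<close>. If
  dom A is contained in dom B, each (x, z) in A factors by going from x to some y along B, back to
  x, then along A to z; hence (iii). Conversely, any factorization through B puts dom A inside dom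
  B. The candidate is linear because inverses and products of linear relations are, which
  \<open>linear_relation_iff\<close> reduces to elementwise closure conditions.\<close>

lemma linear_relation_iff:
  assumes "vector_space sX" and "vector_space sY"
  shows "linear_relation sX sY R \<longleftrightarrow>
    (0, 0) \<in> R \<and>
    (\<forall>x y x' y'. (x, y) \<in> R \<longrightarrow> (x', y') \<in> R \<longrightarrow> (x + x', y + y') \<in> R) \<and>
    (\<forall>c x y. (x, y) \<in> R \<longrightarrow> (sX c x, sY c y) \<in> R)"
proof -
  interpret X: vector_space sX by fact
  interpret Y: vector_space sY by fact
  interpret P: module_prod sX sY by unfold_locales
  show ?thesis
    unfolding linear_relation_def P.p.subspace_def
    by (simp add: Ball_def split_paired_All P.scale_prod zero_prod_def)
qed

lemma linear_relation_converse:
  assumes "vector_space sX" and "vector_space sY" and "linear_relation sX sY R"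
  shows "linear_relation sY sX (R\<inverse>)"
  using assms by (simp add: linear_relation_iff)

text \<open>Sums and scalar multiples of intermediate points in Y serve as intermediate points for
  sums and multiples of pairs.\<close>

lemma linear_relation_relcomp:
  assumes "vector_space sX" and "vector_space sY" and "vector_space sZ"
    and "linear_relation sX sY R" and "linear_relation sY sZ S"
  shows "linear_relation sX sZ (R O S)"
  using assms by (simp add: linear_relation_iff relcomp_unfold) blast

theorem corollary2p3:
  fixes sX :: "'k::real_or_complex \<Rightarrow> 'x::ab_group_add \<Rightarrow> 'x"
    and sY :: "'k \<Rightarrow> 'y::ab_group_add \<Rightarrow> 'y"
    and sZ :: "'k \<Rightarrow> 'z::ab_group_add \<Rightarrow> 'z"
    and A :: "('x \<times> 'z) set" and B :: "('x \<times> 'y) set"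
  assumes "vector_space sX" and "vector_space sY" and "vector_space sZ"
    and "linear_relation sX sZ A" and "linear_relation sX sY B"
  shows "((\<exists>C. linear_relation sY sZ C \<and> A \<subseteq> B O C) \<longleftrightarrow> Domain A \<subseteq> Domain B) \<and>
    (Domain A \<subseteq> Domain B \<longleftrightarrow> A \<subseteq> B O (B\<inverse> O A))"
proof -
  have dom: "Domain A \<subseteq> Domain B" if "A \<subseteq> B O C" for C
    using that by blast
  have sub: "A \<subseteq> B O (B\<inverse> O A)" if "Domain A \<subseteq> Domain B"
    using that by (fastforce simp: relcomp_unfold)
  have "linear_relation sY sZ (B\<inverse> O A)"
    using assms by (meson linear_relation_converse linear_relation_relcomp)
  \<comment> \<open>\<open>dom\<close> gives both (i) to (ii) and, with C =
    \<open>B\<inverse> O A\<close>, (iii) to (ii); that same C, being linear, gives (ii) to (i) by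
    \<open>sub\<close>.\<close>
  with dom sub show ?thesis by blast
qed

end
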